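(* There is a one-to-one correspondence between competitive equilibria of the chores Fisher market (with $n$ agents, $m$ divisible chores, disutilities $d_{ij}$ and earning requirements $B_i\ge 0$) and the KKT points of the program $$\max_{\beta\ge0,\;p\ge0}\ \sum_j p_j-\sum_i B_i\log(\beta_i)\quad\text{s.t.}\quad p_j\le\beta_i d_{ij}\ \ \forall\, i,j,\qquad \sum_j p_j=\sum_i B_i.$$
   Context: Notation: $[k]=\{1,\dots,k\}$; $\langle\cdot,\cdot\rangle$ is the Euclidean inner product; $d_i=(d_{i1},\dots,d_{im})$ and $x_i=(x_{i1},\dots,x_{im})$; indices $i$ range over $[n]$ and $j$ over $[m]$. Chores Fisher market: there are $n$ agents and $m$ divisible chores. Agent $i$ has disutility $d_{ij}$ for one unit of chore $j$, hence total disutility $\langle d_i,x_i\rangle=\sum_{j} d_{ij}x_{ij}$ for a bundle $x_i\in\mathbb{R}^m_{\ge0}$, and has an earning requirement of $B_i\ge0$ units of money. Competitive equilibrium (CE): a price vector $p\in\mathbb{R}^m_{\ge0}$ and an allocation $x\in\mathbb{R}^{n\times m}_{\ge0}$ such that (E1) $\langle p,x_i\rangle=B_i$ for all $i\in[n]$; (E2) $\langle d_i,x_i\rangle\le\langle d_i,y_i\rangle$ for all bundles $y_i$ with $\langle p,y_i\rangle\ge\langle p,x_i\rangle$, for all $i\in[n]$; (E3) $\sum_i x_{ij}=1$ for all $j\in[m]$. KKT point of the program: primal variables $(p,\beta)$ together with dual variables $(x,\mu)$, where $x_{ij}$ is the multiplier of the constraint $p_j\le\beta_i d_{ij}$ and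 $\mu$ is the multiplier of the constraint $\sum_j p_j=\sum_i B_i$, satisfying the KKT conditions (i) $p\ge0$, $x\ge0$, $\beta>0$ (strict positivity of $\beta$ comes from the domain of the logarithm); (ii) $d_{ij}\beta_i\ge p_j$ and $x_{ij}(d_{ij}\beta_i-p_j)=0$ for all $i\in[n]$, $j\in[m]$; (iii) $\sum_j p_j=\sum_i B_i$; (iv) $\sum_i x_{ij}+\mu\ge1$ and $p_j\left(\sum_i x_{ij}+\mu-1\right)=0$ for all $j\in[m]$; (v) $\sum_j d_{ij}x_{ij}\ge \frac{B_i}{\beta_i}$ and $\beta_i\left(\sum_j d_{ij}x_{ij}-\frac{B_i}{\beta_i}\right)=0$ for all $i\in[n]$.
   Formalization: Assumes all d_ij > 0 and some B_i > 0; the bijection (p,β,x,μ) ↦ (p,x) is claimed only when all B_i > 0. If some B_i = 0, that β_i can be raised freely, so the map is onto the equilibria and one-to-one only up to those β_i. The claim fails for B = 0 or d_ij = 0. *)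

theory Defs
  imports "HOL-Analysis.Analysis"
begin

text \<open>
  Agents and chores are the elements of the finite types \<open>'n\<close> and \<open>'m\<close>. Row \<open>i\<close> of \<open>d\<close> (of \<open>x\<close>) holds
  the disutilities (the bundle) of agent \<open>i\<close>.
\<close>

definition competitive_equilibrium ::
  "real^'m^'n \<Rightarrow> real^'n \<Rightarrow> real^'m \<Rightarrow> real^'m^'n \<Rightarrow> bool" where
  "competitive_equilibrium d B p x \<longleftrightarrow>
     (\<forall>j. 0 \<le> p $ j) \<and> (\<forall>i j. 0 \<le> x $ i $ j) \<and>
     (\<forall>i. p \<bullet> x $ i = B $ i) \<and>
     (\<forall>i y. (\<forall>j. 0 \<le> y $ j) \<longrightarrow> p \<bullet> y \<ge> p \<bullet> x $ i \<longrightarrow> d $ i \<bullet> x $ i \<le> d $ i \<bullet> y) \<and>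
     (\<forall>j. (\<Sum>i\<in>UNIV. x $ i $ j) = 1)"

definition objective :: "real^'n \<Rightarrow> real^'m \<Rightarrow> real^'n \<Rightarrow> real" where
  "objective B p \<beta> = (\<Sum>j\<in>UNIV. p $ j) - (\<Sum>i\<in>UNIV. B $ i * ln (\<beta> $ i))"

definition feasible :: "real^'m^'n \<Rightarrow> real^'n \<Rightarrow> real^'m \<Rightarrow> real^'n \<Rightarrow> bool" where
  "feasible d B p \<beta> \<longleftrightarrow>
     (\<forall>i. 0 \<le> \<beta> $ i) \<and> (\<forall>j. 0 \<le> p $ j) \<and>
     (\<forall>i j. p $ j \<le> \<beta> $ i * d $ i $ j) \<and>
     (\<Sum>j\<in>UNIV. p $ j) = (\<Sum>i\<in>UNIV. B $ i)"

definition lagrangian ::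
  "real^'m^'n \<Rightarrow> real^'n \<Rightarrow> real^'m \<Rightarrow> real^'n \<Rightarrow> real^'m^'n \<Rightarrow> real \<Rightarrow> real" where
  "lagrangian d B p \<beta> x \<mu> =
     objective B p \<beta> - (\<Sum>i\<in>UNIV. \<Sum>j\<in>UNIV. x $ i $ j * (p $ j - \<beta> $ i * d $ i $ j))
       - \<mu> * ((\<Sum>j\<in>UNIV. p $ j) - (\<Sum>i\<in>UNIV. B $ i))"

text \<open>
  KKT points of maximising \<open>objective B\<close> over \<open>feasible d B\<close>: primal variables \<open>(p, \<beta>)\<close> with
  multipliers \<open>x\<close> for \<open>p $ j \<le> \<beta> $ i * d $ i $ j\<close> and \<open>\<mu>\<close> (of either sign) for the equation on total prices.
  The requirement \<open>\<beta> > 0\<close> is the domain of the logarithm, which \<open>ln\<close> being total does not enforce.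
  The last four conditions are stationarity of the Lagrangian in \<open>p\<close> and in \<open>\<beta>\<close>. Since \<open>\<beta> > 0\<close>, the
  equation in the last line makes the inequality before it an equality, so that the direction of
  that inequality does not matter.
\<close>

definition kkt_point ::
  "real^'m^'n \<Rightarrow> real^'n \<Rightarrow> real^'m \<Rightarrow> real^'n \<Rightarrow> real^'m^'n \<Rightarrow> real \<Rightarrow> bool" where
  "kkt_point d B p \<beta> x \<mu> \<longleftrightarrow>
     (\<forall>j. 0 \<le> p $ j) \<and> (\<forall>i j. 0 \<le> x $ i $ j) \<and> (\<forall>i. 0 < \<beta> $ i) \<and>
     (\<forall>i j. d $ i $ j * \<beta> $ i \<ge> p $ j) \<and>
     (\<forall>i j. x $ i $ j * (d $ i $ j * \<beta> $ i - p $ j) = 0) \<and>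
     (\<Sum>j\<in>UNIV. p $ j) = (\<Sum>i\<in>UNIV. B $ i) \<and>
     (\<forall>j. (\<Sum>i\<in>UNIV. x $ i $ j) + \<mu> \<ge> 1) \<and>
     (\<forall>j. p $ j * ((\<Sum>i\<in>UNIV. x $ i $ j) + \<mu> - 1) = 0) \<and>
     (\<forall>i. d $ i \<bullet> x $ i \<ge> B $ i / \<beta> $ i) \<and>
     (\<forall>i. \<beta> $ i * (d $ i \<bullet> x $ i - B $ i / \<beta> $ i) = 0)"

lemma kkt_point_feasible: "kkt_point d B p \<beta> x \<mu> \<Longrightarrow> feasible d B p \<beta>"
  unfolding kkt_point_def feasible_def by (auto simp: mult.commute less_imp_le)

definition competitive_equilibria :: "real^'m^'n \<Rightarrow> real^'n \<Rightarrow> ((real^'m) \<times> (real^'m^'n)) set" where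
  "competitive_equilibria d B = {(p, x). competitive_equilibrium d B p x}"

definition kkt_points ::
  "real^'m^'n \<Rightarrow> real^'n \<Rightarrow> (((real^'m) \<times> (real^'n)) \<times> ((real^'m^'n) \<times> real)) set" where
  "kkt_points d B = {((p, \<beta>), (x, \<mu>)). kkt_point d B p \<beta> x \<mu>}"

fun prices_and_allocation ::
  "((real^'m) \<times> (real^'n)) \<times> ((real^'m^'n) \<times> real) \<Rightarrow> (real^'m) \<times> (real^'m^'n)" where
  "prices_and_allocation ((p, \<beta>), (x, \<mu>)) = (p, x)"

lemma lagrangian_gradient:
  fixes d :: "real^'m^'n"
  assumes "\<And>i. 0 < \<beta> $ i"
  shows "((\<lambda>(p, \<beta>). lagrangian d B p \<beta> x \<mu>) has_derivative
           (\<lambda>(u, v). (\<Sum>j\<in>UNIV. (1 - (\<Sum>i\<in>UNIV. x $ i $ j) - \<mu>) * u $ j)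
                   + (\<Sum>i\<in>UNIV. (d $ i \<bullet> x $ i - B $ i / \<beta> $ i) * v $ i))) (at (p, \<beta>))"
proof -
  have pos: "snd (p, \<beta>) $ i > 0" for i using assms by simp
  have eq: "(\<Sum>j\<in>UNIV. u $ j) - (\<Sum>i\<in>UNIV. B $ i * (v $ i / \<beta> $ i))
        - (\<Sum>i\<in>UNIV. \<Sum>j\<in>UNIV. x $ i $ j * (u $ j - v $ i * d $ i $ j)) - \<mu> * (\<Sum>j\<in>UNIV. u $ j)
      = (\<Sum>j\<in>UNIV. (1 - (\<Sum>i\<in>UNIV. x $ i $ j) - \<mu>) * u $ j)
        + (\<Sum>i\<in>UNIV. (d $ i \<bullet> x $ i - B $ i / \<beta> $ i) * v $ i)"
    for u :: "real^'m" and v :: "real^'n"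
  proof -
    have "(\<Sum>i\<in>UNIV. \<Sum>j\<in>UNIV. x $ i $ j * (u $ j - v $ i * d $ i $ j))
        = (\<Sum>j\<in>UNIV. (\<Sum>i\<in>UNIV. x $ i $ j) * u $ j) - (\<Sum>i\<in>UNIV. (d $ i \<bullet> x $ i) * v $ i)"
      by (subst sum_distrib_right, subst sum.swap)
         (simp add: inner_vec_def sum_distrib_right sum_distrib_left sum_subtractf right_diff_distrib
           sum.swap[of _ "UNIV :: 'n set"] mult_ac)
    then show ?thesis
      by (simp add: left_diff_distrib sum_subtractf sum_distrib_left)
  qed
  have [derivative_intros]:
      "((\<lambda>z. fst z $ j) has_derivative (\<lambda>z. fst z $ j)) (at (p, \<beta>))"
      "((\<lambda>z. snd z $ i) has_derivative (\<lambda>z. snd z $ i)) (at (p, \<beta>))" for i j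
    by (intro bounded_linear_imp_has_derivative bounded_linear_compose[OF bounded_linear_vec_nth]
          bounded_linear_fst bounded_linear_snd)+
  have "((\<lambda>z. (\<Sum>j\<in>UNIV. fst z $ j) - (\<Sum>i\<in>UNIV. B $ i * ln (snd z $ i))
          - (\<Sum>i\<in>UNIV. \<Sum>j\<in>UNIV. x $ i $ j * (fst z $ j - snd z $ i * d $ i $ j))
          - \<mu> * ((\<Sum>j\<in>UNIV. fst z $ j) - (\<Sum>i\<in>UNIV. B $ i)))
      has_derivative (\<lambda>z. (\<Sum>j\<in>UNIV. fst z $ j) - (\<Sum>i\<in>UNIV. B $ i * (snd z $ i / \<beta> $ i))
          - (\<Sum>i\<in>UNIV. \<Sum>j\<in>UNIV. x $ i $ j * (fst z $ j - snd z $ i * d $ i $ j))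
          - \<mu> * (\<Sum>j\<in>UNIV. fst z $ j))) (at (p, \<beta>))"
    using pos by (auto intro!: derivative_eq_intros simp: divide_inverse)
  then show ?thesis
    unfolding lagrangian_def objective_def case_prod_beta eq .
qed

text \<open>
  Two degenerate cases limit how far the correspondence can be a bijection. An agent with
  \<open>B $ i = 0\<close> leaves \<open>\<beta> $ i\<close> undetermined from above, and if all earning requirements vanish
  there are KKT points although there is no equilibrium.
\<close>

lemma kkt_point_raise_beta:
  fixes d :: "real^'m^'n"
  assumes d: "\<And>i j. 0 < d $ i $ j" and kkt: "kkt_point d B p \<beta> x \<mu>"
    and B: "B $ k = 0" and t: "\<beta> $ k \<le> t"
  shows "kkt_point d B p (\<chi> i. if i = k then t else \<beta> $ i) x \<mu>"
proof -
  have pos: "0 < \<beta> $ k" and x: "0 \<le> x $ k $ j" and pr: "p $ j \<le> d $ k $ j * \<beta> $ k"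
    and "\<beta> $ k * (d $ k \<bullet> x $ k - B $ k / \<beta> $ k) = 0" for j
    using kkt by (auto simp: kkt_point_def)
  then have dx: "d $ k \<bullet> x $ k = 0"
    using B by simp
  have "\<forall>j\<in>UNIV. d $ k $ j * x $ k $ j = 0"
    using dx d x by (subst sum_nonneg_eq_0_iff[symmetric]) (auto simp: inner_vec_def less_imp_le)
  then have x0: "x $ k $ j = 0" for j
    using d by (metis UNIV_I less_irrefl mult_eq_0_iff)
  have "p $ j \<le> d $ k $ j * t" for j
    using pr[of j] mult_left_mono[OF t, of "d $ k $ j"] d[of k j] by linarith
  then show ?thesis
    using kkt less_le_trans[OF pos t] B dx x0 by (auto simp: kkt_point_def)
qed

lemma zero_requirements:
  fixes d :: "real^'m^'n"
  assumes d: "\<And>i j. 0 < d $ i $ j"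
  shows "kkt_point d 0 0 (\<chi> i. 1) 0 1" and "\<not> competitive_equilibrium d 0 p x"
proof -
  show "kkt_point d 0 0 (\<chi> i. 1) 0 1"
    using d by (auto simp: kkt_point_def less_imp_le)
  show "\<not> competitive_equilibrium d 0 p x"
  proof
    assume ce: "competitive_equilibrium d 0 p x"
    then have x: "0 \<le> x $ i $ j" and px: "p \<bullet> x $ i = 0"
      and col: "(\<Sum>i\<in>UNIV. x $ i $ j) = 1" for i j
      by (auto simp: competitive_equilibrium_def)
    have "d $ i \<bullet> x $ i \<le> d $ i \<bullet> 0" for i
      using ce px[of i] unfolding competitive_equilibrium_def
      by (metis inner_zero_right order_refl zero_index)
    then have dx: "d $ i \<bullet> x $ i \<le> 0" for i
      by simp
    have "d $ i $ j * x $ i $ j \<le> d $ i \<bullet> x $ i" for i j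
      using member_le_sum[of j UNIV "\<lambda>j. d $ i $ j * x $ i $ j"] d x
      by (auto simp: inner_vec_def less_imp_le)
    then have "x $ i $ j \<le> 0" for i j
      using dx[of i] d[of i j] by (smt (verit) zero_less_mult_iff)
    then have "(\<Sum>i\<in>UNIV. x $ i $ j) \<le> 0" for j
      by (intro sum_nonpos)
    then show False
      using col by (metis not_one_le_zero)
  qed
qed

end

theory Submission
  imports Defs
begin

text \<open>
  Summing complementary slackness over the rows and over the columns of \<open>x\<close> gives
  \<open>\<mu> * (\<Sum>j. p $ j) = 0\<close>, so \<open>\<mu> = 0\<close> once some requirement is positive. A chore of price zero
  would be allocated to nobody, contradicting \<open>(\<Sum>i. x $ i $ j) \<ge> 1\<close>; so prices are positive and
  the market clears. For \<open>B $ i > 0\<close> the number \<open>1 / \<beta> $ i\<close> is the minimal disutility per unit of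
  money, so that the constraints \<open>p $ j \<le> \<beta> $ i * d $ i $ j\<close> together with complementary slackness
  express the optimality of the bundle \<open>x $ i\<close>.
\<close>

lemma competitive_equilibrium_optimal:
  assumes "competitive_equilibrium d B p x" "\<And>j. 0 \<le> y $ j" "B $ i \<le> p \<bullet> y"
  shows "d $ i \<bullet> x $ i \<le> d $ i \<bullet> y"
  using assms unfolding competitive_equilibrium_def by auto

lemma sum_inner_rows:
  fixes p :: "real^'m" and x :: "real^'m^'n"
  shows "(\<Sum>i\<in>UNIV. p \<bullet> x $ i) = (\<Sum>j\<in>UNIV. p $ j * (\<Sum>i\<in>UNIV. x $ i $ j))"
  unfolding inner_vec_def sum_distrib_left by (subst sum.swap) simp

lemma inner_row_slack:
  fixes d x p :: "real^'m"
  shows "(\<Sum>j\<in>UNIV. x $ j * (d $ j * b - p $ j)) = b * (d \<bullet> x) - p \<bullet> x"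
  by (simp add: inner_vec_def sum_distrib_left right_diff_distrib sum_subtractf mult_ac)

lemma inner_pos_nonneg_eq_0:
  fixes d x :: "real^'m"
  assumes "\<And>j. 0 < d $ j" "\<And>j. 0 \<le> x $ j" "d \<bullet> x \<le> 0"
  shows "x = 0"
proof -
  have "(\<Sum>j\<in>UNIV. d $ j * x $ j) = 0"
    using assms by (intro antisym sum_nonneg) (auto simp: inner_vec_def less_imp_le)
  then have "\<forall>j\<in>UNIV. d $ j * x $ j = 0"
    using assms by (subst (asm) sum_nonneg_eq_0_iff) (auto simp: less_imp_le)
  then show ?thesis
    using assms(1) by (auto simp: vec_eq_iff) (metis less_irrefl)
qed

lemma kkt_point_disutility:
  assumes "kkt_point d B p \<beta> x \<mu>"
  shows "\<beta> $ i * (d $ i \<bullet> x $ i) = B $ i"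
proof -
  have "0 < \<beta> $ i" and "\<beta> $ i * (d $ i \<bullet> x $ i - B $ i / \<beta> $ i) = 0"
    using assms by (auto simp: kkt_point_def)
  then show ?thesis by (auto simp: field_simps)
qed

text \<open>Complementary slackness summed over row \<open>i\<close> equates the earnings with
  \<open>\<beta> $ i * (d $ i \<bullet> x $ i)\<close>.\<close>

lemma kkt_point_earning:
  assumes "kkt_point d B p \<beta> x \<mu>"
  shows "p \<bullet> x $ i = B $ i"
proof -
  have "x $ i $ j * (d $ i $ j * \<beta> $ i - p $ j) = 0" for j
    using assms by (auto simp: kkt_point_def)
  then have "\<beta> $ i * (d $ i \<bullet> x $ i) - p \<bullet> x $ i = 0"
    by (subst inner_row_slack[symmetric]) (intro sum.neutral ballI)
  then show ?thesis
    using kkt_point_disutility[OF assms, of i] by simp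
qed

text \<open>All money is counted twice: by agents it is the sum of the requirements, by chores it is
  \<open>1 - \<mu>\<close> times the sum of the prices. These two sums agree and are
  positive.\<close>

lemma kkt_point_multiplier_eq_0:
  fixes d :: "real^'m^'n"
  assumes kkt: "kkt_point d B p \<beta> x \<mu>" and "0 < (\<Sum>i\<in>UNIV. B $ i)"
  shows "\<mu> = 0"
proof -
  have total: "(\<Sum>j\<in>UNIV. p $ j) = (\<Sum>i\<in>UNIV. B $ i)"
    and slack: "p $ j * ((\<Sum>i\<in>UNIV. x $ i $ j) + \<mu> - 1) = 0" for j
    using kkt by (auto simp: kkt_point_def)
  have "p $ j * (\<Sum>i\<in>UNIV. x $ i $ j) = p $ j - \<mu> * p $ j" for j
    using slack[of j] by (simp add: algebra_simps)
  then have "(\<Sum>i\<in>UNIV. p \<bullet> x $ i) = (\<Sum>j\<in>UNIV. p $ j) - \<mu> * (\<Sum>j\<in>UNIV. p $ j)"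
    by (simp add: sum_inner_rows sum_subtractf sum_distrib_left)
  then show ?thesis
    using assms(2) total kkt_point_earning[OF kkt] by simp
qed

lemma kkt_point_imp_equilibrium:
  fixes d :: "real^'m^'n"
  assumes d: "\<And>i j. 0 < d $ i $ j" and pos: "0 < (\<Sum>i\<in>UNIV. B $ i)"
    and kkt: "kkt_point d B p \<beta> x \<mu>"
  shows "competitive_equilibrium d B p x"
proof -
  have p: "0 \<le> p $ j" and x: "0 \<le> x $ i $ j" and \<beta>: "0 < \<beta> $ i"
    and price: "p $ j \<le> d $ i $ j * \<beta> $ i"
    and slack: "x $ i $ j * (d $ i $ j * \<beta> $ i - p $ j) = 0"
    and "(\<Sum>i\<in>UNIV. x $ i $ j) + \<mu> \<ge> 1"
    and "p $ j * ((\<Sum>i\<in>UNIV. x $ i $ j) + \<mu> - 1) = 0" for i j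
    using kkt by (auto simp: kkt_point_def)
  then have col_ge: "(\<Sum>i\<in>UNIV. x $ i $ j) \<ge> 1"
    and col_slack: "p $ j * ((\<Sum>i\<in>UNIV. x $ i $ j) - 1) = 0" for j
    using kkt_point_multiplier_eq_0[OF kkt pos] by simp_all
  \<comment> \<open>At price zero the factor \<open>d $ i $ j * \<beta> $ i - p $ j\<close> is
    positive for every agent, so slackness empties column \<open>j\<close>.\<close>
  have "p $ j \<noteq> 0" for j
  proof
    assume "p $ j = 0"
    then have "x $ i $ j = 0" for i
      using slack[of i j] d[of i j] \<beta>[of i] by auto
    then show False
      using col_ge[of j] by simp
  qed
  then have col: "(\<Sum>i\<in>UNIV. x $ i $ j) = 1" for j
    using col_slack[of j] by simp
  \<comment> \<open>Weak duality: no bundle earns more than \<open>\<beta> $ i\<close> per unit of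
    disutility, and \<open>x $ i\<close> attains this rate.\<close>
  have opt: "d $ i \<bullet> x $ i \<le> d $ i \<bullet> y" if y: "\<And>j. 0 \<le> y $ j" "p \<bullet> x $ i \<le> p \<bullet> y" for i y
  proof -
    have "\<beta> $ i * (d $ i \<bullet> x $ i) \<le> p \<bullet> y"
      using y(2) kkt_point_earning[OF kkt] kkt_point_disutility[OF kkt] by simp
    also have "\<dots> \<le> \<beta> $ i * (d $ i \<bullet> y)"
      unfolding inner_vec_def sum_distrib_left
      using mult_right_mono[OF price y(1)] by (intro sum_mono) (simp add: mult_ac)
    finally show ?thesis
      using \<beta> by simp
  qed
  show ?thesis
    unfolding competitive_equilibrium_def
    using p x col opt kkt_point_earning[OF kkt] by blast
qed

text \<open>Market clearing permits \<open>\<mu> = 0\<close>. The entries of \<open>\<beta>\<close>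
  are then chosen agent by agent; a positive requirement forces
  \<open>B $ i / (d $ i \<bullet> x $ i)\<close>.\<close>

lemma equilibrium_imp_kkt_point:
  fixes d :: "real^'m^'n"
  assumes d: "\<And>i j. 0 < d $ i $ j" and B: "\<And>i. 0 \<le> B $ i"
    and ce: "competitive_equilibrium d B p x"
  obtains \<beta> where "kkt_point d B p \<beta> x 0"
proof -
  have p: "0 \<le> p $ j" and x: "0 \<le> x $ i $ j" and earn: "p \<bullet> x $ i = B $ i"
    and col: "(\<Sum>i\<in>UNIV. x $ i $ j) = 1" for i j
    using ce by (auto simp: competitive_equilibrium_def)
  have row: "\<exists>b>0. (\<forall>j. p $ j \<le> d $ i $ j * b) \<and> b * (d $ i \<bullet> x $ i) = B $ i" for i
  proof (cases "B $ i = 0")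
    case True
    \<comment> \<open>With requirement zero, the zero bundle is an admissible competitor.\<close>
    have "d $ i \<bullet> x $ i \<le> d $ i \<bullet> 0"
      using True by (intro competitive_equilibrium_optimal[OF ce]) auto
    then have "x $ i = 0"
      using d x by (intro inner_pos_nonneg_eq_0) auto
    \<comment> \<open>Any positive upper bound of the ratios \<open>p $ j / d $ i $ j\<close> would
      do. Their sum bounds each of them, and the added 1 keeps \<open>b\<close> positive even if all
      prices vanish.\<close>
    define b where "b = 1 + (\<Sum>j\<in>UNIV. p $ j / d $ i $ j)"
    have nonneg: "0 \<le> p $ j / d $ i $ j" for j
      using p d[of i j] by simp
    have "0 < b"
      unfolding b_def using nonneg by (intro add_pos_nonneg sum_nonneg) auto
    moreover have "p $ j \<le> d $ i $ j * b" for j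
    proof -
      have "p $ j / d $ i $ j \<le> b"
        unfolding b_def using member_le_sum[of j UNIV "\<lambda>j. p $ j / d $ i $ j"] nonneg by force
      then show ?thesis
        using d[of i j] by (simp add: pos_divide_le_eq mult.commute)
    qed
    ultimately show ?thesis
      using True \<open>x $ i = 0\<close> by auto
  next
    case False
    then have Bi: "0 < B $ i"
      using B[of i] by simp
    have "x $ i \<noteq> 0"
      using earn[of i] False by auto
    then have dx: "0 < d $ i \<bullet> x $ i"
      using inner_pos_nonneg_eq_0[of "d $ i" "x $ i"] d x by force
    have "p $ j \<le> d $ i $ j * (B $ i / (d $ i \<bullet> x $ i))" for j
    proof (cases "p $ j = 0")
      case True
      then show ?thesis
        using d[of i j] Bi dx by simp
    next
      case False
      then have pj: "0 < p $ j"
        using p[of j] by simp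
      \<comment> \<open>The competitor consists of chore \<open>j\<close> alone, in the amount that
        earns exactly \<open>B $ i\<close>.\<close>
      have "0 \<le> axis j (B $ i / p $ j) $ k" for k
        using pj Bi by (simp add: axis_def)
      moreover have "B $ i \<le> p \<bullet> axis j (B $ i / p $ j)"
        using pj by (simp add: inner_axis)
      ultimately have "d $ i \<bullet> x $ i \<le> d $ i \<bullet> axis j (B $ i / p $ j)"
        by (rule competitive_equilibrium_optimal[OF ce])
      then show ?thesis
        using pj dx by (simp add: inner_axis field_simps)
    qed
    then show ?thesis
      using Bi dx by (intro exI[of _ "B $ i / (d $ i \<bullet> x $ i)"]) auto
  qed
  then obtain b where b: "\<And>i. 0 < b i" "\<And>i j. p $ j \<le> d $ i $ j * b i"
      "\<And>i. b i * (d $ i \<bullet> x $ i) = B $ i"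
    by metis
  \<comment> \<open>The row sum is
    \<open>b i * (d $ i \<bullet> x $ i) - p \<bullet> x $ i = 0\<close>, and its terms are
    nonnegative, so each one vanishes.\<close>
  have slack: "x $ i $ j * (d $ i $ j * b i - p $ j) = 0" for i j
  proof -
    have "(\<Sum>j\<in>UNIV. x $ i $ j * (d $ i $ j * b i - p $ j)) = 0"
      by (simp add: inner_row_slack b(3) earn)
    then have "\<forall>j\<in>UNIV. x $ i $ j * (d $ i $ j * b i - p $ j) = 0"
      by (subst (asm) sum_nonneg_eq_0_iff) (auto intro!: mult_nonneg_nonneg simp: x b(2))
    then show ?thesis by blast
  qed
  have "(\<Sum>j\<in>UNIV. p $ j) = (\<Sum>i\<in>UNIV. B $ i)"
    using sum_inner_rows[of p x] by (simp add: earn col)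
  moreover have "d $ i \<bullet> x $ i = B $ i / b i" for i
    using b(1)[of i] b(3)[of i] by (simp add: field_simps)
  ultimately have "kkt_point d B p (\<chi> i. b i) x 0"
    unfolding kkt_point_def using p x col b(1,2) slack by simp
  then show ?thesis by (rule that)
qed

text \<open>A bijection is claimed only for positive requirements because
  \<open>kkt_point_raise_beta\<close> lets \<open>\<beta> $ i\<close> grow when
  \<open>B $ i = 0\<close>. In general the correspondence is onto, with \<open>\<mu>\<close> and the
  remaining entries of \<open>\<beta>\<close> determined by \<open>p\<close> and
  \<open>x\<close>.\<close>

theorem theorem3:
  fixes d :: "real^'m^'n" and B :: "real^'n"
  assumes "\<And>i j. 0 < d $ i $ j"
    and "\<And>i. 0 \<le> B $ i"
    and "\<exists>i. 0 < B $ i"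
  shows "((\<forall>i. 0 < B $ i) \<longrightarrow>
        bij_betw prices_and_allocation (kkt_points d B) (competitive_equilibria d B)) \<and>
      prices_and_allocation ` kkt_points d B = competitive_equilibria d B \<and>
      (\<forall>p x \<beta> \<mu> \<beta>' \<mu>'. kkt_point d B p \<beta> x \<mu> \<longrightarrow> kkt_point d B p \<beta>' x \<mu>' \<longrightarrow>
         \<mu> = \<mu>' \<and> (\<forall>i. 0 < B $ i \<longrightarrow> \<beta> $ i = \<beta>' $ i))"
proof -
  have pos: "0 < (\<Sum>i\<in>UNIV. B $ i)"
    using assms(2,3) by (metis UNIV_I finite sum_pos2)
  have image: "prices_and_allocation ` kkt_points d B = competitive_equilibria d B"
  proof (intro equalityI subsetI)
    fix z assume "z \<in> prices_and_allocation ` kkt_points d B"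
    then show "z \<in> competitive_equilibria d B"
      using kkt_point_imp_equilibrium[OF assms(1) pos]
      by (auto simp: kkt_points_def competitive_equilibria_def)
  next
    fix z assume "z \<in> competitive_equilibria d B"
    then obtain p x where z: "z = (p, x)" and ce: "competitive_equilibrium d B p x"
      by (auto simp: competitive_equilibria_def)
    obtain \<beta> where "kkt_point d B p \<beta> x 0"
      using equilibrium_imp_kkt_point[OF assms(1,2) ce] .
    then have "((p, \<beta>), (x, 0)) \<in> kkt_points d B"
      by (simp add: kkt_points_def)
    then show "z \<in> prices_and_allocation ` kkt_points d B"
      unfolding z by (rule rev_image_eqI) simp
  qed
  have unique: "\<mu> = \<mu>' \<and> (\<forall>i. 0 < B $ i \<longrightarrow> \<beta> $ i = \<beta>' $ i)"
    if "kkt_point d B p \<beta> x \<mu>" "kkt_point d B p \<beta>' x \<mu>'" for p x \<beta> \<mu> \<beta>' \<mu>'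
  proof (intro conjI allI impI)
    show "\<mu> = \<mu>'"
      using that[THEN kkt_point_multiplier_eq_0, OF pos] by simp
    fix i assume "0 < B $ i"
    moreover have "\<beta> $ i * (d $ i \<bullet> x $ i) = B $ i" "\<beta>' $ i * (d $ i \<bullet> x $ i) = B $ i"
      using that[THEN kkt_point_disutility] by auto
    \<comment> \<open>Since \<open>B $ i\<close> is nonzero, so is the common factor
      \<open>d $ i \<bullet> x $ i\<close>, which cancels.\<close>
    ultimately show "\<beta> $ i = \<beta>' $ i"
      by (metis less_irrefl mult_cancel_right mult_zero_right)
  qed
  have "inj_on prices_and_allocation (kkt_points d B)" if B: "\<forall>i. 0 < B $ i"
  proof (rule inj_onI)
    fix z z' assume z: "z \<in> kkt_points d B" "z' \<in> kkt_points d B"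
      and eq: "prices_and_allocation z = prices_and_allocation z'"
    obtain p \<beta> x \<mu> where z_eq: "z = ((p, \<beta>), (x, \<mu>))"
      by (metis surj_pair)
    obtain \<beta>' \<mu>' where z'_eq: "z' = ((p, \<beta>'), (x, \<mu>'))"
      using eq z_eq by (cases z' rule: prices_and_allocation.cases) auto
    have "kkt_point d B p \<beta> x \<mu>" "kkt_point d B p \<beta>' x \<mu>'"
      using z unfolding z_eq z'_eq by (simp_all add: kkt_points_def)
    from unique[OF this] show "z = z'"
      using B by (simp add: z_eq z'_eq vec_eq_iff)
  qed
  then show ?thesis
    using image unique unfolding bij_betw_def by blast
qed

end
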